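(* Let $p\in[1,\infty)$, $L>0$, let $f:\mathcal{X}\to\mathcal{Y}$ be $L$-Lipschitz with respect to the $\ell_p$ norm, let $S\subseteq\Omega$ be nonempty, let $\gamma\in[0,1]$ and $(X,Y)\in\mathcal{X}\times\mathcal{K}^{|\Omega|}$. Let $n_\gamma=\lceil(1-\gamma)|S|\rceil$, and let $$R_\kappa(X,Y)=\inf\Big\{\epsilon\in\mathbb{R}^+\;:\;\exists\,\tilde X\in\mathcal{B}_p^{\epsilon}(X),\ \frac1{|S|}\sum_{\omega\in S}\mathbf{1}_{\tilde Y_\omega=Y_\omega}\le\gamma\Big\}$$ with $\tilde Y_\omega=\arg\max_{k\in\mathcal{K}}f^k(\tilde X)_\omega$. With $c_\omega=R^\omega(X,Y)^p$, $$R_\kappa(X,Y)^p\;\ge\;\min\Big\{\sum_{\omega\in S}c_\omega p_\omega: p_\omega\in\{0,1\},\ \sum_{\omega\in S}p_\omega\ge n_\gamma\Big\}\;=\;\sum_{k=1}^{n_\gamma}R^{\pi_X(k)}(X,Y)^p,$$ where $\pi_X:\{1,\dots,|S|\}\to S$ is a bijection sorting $S$ in ascending order of $R^\omega(X,Y)$.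
   Context: $\Omega$ is a finite nonempty set of coordinates (pixels), $\mathcal{K}$ is a finite set of classes with $|\mathcal{K}|\ge2$, $\mathcal{X}=[0,1]^{|\Omega|}$, $\mathcal{Y}=\mathbb{R}^{|\mathcal{K}|\times|\Omega|}$ with the entrywise $\ell_p$ norm. A function $f:\mathcal{X}\to\mathcal{Y}$ is $L$-Lipschitz in $\ell_p$ norm if $\|f(X_1)-f(X_2)\|_p\le L\|X_1-X_2\|_p$ for all $X_1,X_2\in\mathcal{X}$. $f^k(X)_\omega$ is the output for class $k$ at coordinate $\omega$. $\mathcal{B}_p^{\epsilon}(X)=\{\tilde X\in\mathcal{X}:\|\tilde X-X\|_p\le\epsilon\}$, $\mathbb{R}^+=[0,\infty)$, and $\inf\emptyset=+\infty$. The predicted class is $\hat Y_\omega=\arg\max_{k}f^k(X)_\omega$ (with any fixed tie-breaking rule). The margin $\mathcal{M}_X^\omega(f)=f^{\mathrm{top1}}(X)_\omega-f^{\mathrm{top2}}(X)_\omega\ge0$ is the difference between the largest and second largest (with multiplicity) of the values $f^k(X)_\omega$, $k\in\mathcal{K}$. The per-pixel robustness is $$R^\omega(X,Y)=\mathbf{1}_{\hat Y_\omega=Y_\omega}\cdot 2^{\frac{1-p}{p}}\cdot\mathcal{M}_X^\omega(f)/L .$$ *)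

theory Defs
  imports "HOL-Analysis.Analysis"
begin

definition lp_norm :: "real \<Rightarrow> ('i::finite \<Rightarrow> real) \<Rightarrow> real" where
  "lp_norm p v = (\<Sum>i\<in>UNIV. \<bar>v i\<bar> powr p) powr (1 / p)"

abbreviation lp_norm_vec :: "real \<Rightarrow> real^'w::finite \<Rightarrow> real" where
  "lp_norm_vec p x \<equiv> lp_norm p (\<lambda>\<omega>. x $ \<omega>)"

abbreviation lp_norm_mat :: "real \<Rightarrow> real^'w::finite^'k::finite \<Rightarrow> real" where
  "lp_norm_mat p A \<equiv> lp_norm p (\<lambda>(k, \<omega>). A $ k $ \<omega>)"

definition unit_cube :: "(real^'w::finite) set" where
  "unit_cube = {x. \<forall>\<omega>. 0 \<le> x $ \<omega> \<and> x $ \<omega> \<le> 1}"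

text \<open>Classifiers are total functions, but only their values on the unit cube matter:
  \<open>f x $ k $ \<omega>\<close> is the score of class \<open>k\<close> at pixel \<open>\<omega>\<close>.\<close>

definition lp_lipschitz :: "real \<Rightarrow> real \<Rightarrow> (real^'w::finite \<Rightarrow> real^'w^'k::finite) \<Rightarrow> bool" where
  "lp_lipschitz p L f \<longleftrightarrow>
     (\<forall>x1\<in>unit_cube. \<forall>x2\<in>unit_cube. lp_norm_mat p (f x1 - f x2) \<le> L * lp_norm_vec p (x1 - x2))"

definition lp_ball :: "real \<Rightarrow> real \<Rightarrow> real^'w::finite \<Rightarrow> (real^'w) set" where
  "lp_ball p \<epsilon> x = {x' \<in> unit_cube. lp_norm_vec p (x' - x) \<le> \<epsilon>}"

text \<open>An arg max together with its tie-breaking rule: a map choosing one maximising class for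
  every vector of class scores.\<close>

definition argmax_rule :: "(('k::finite \<Rightarrow> real) \<Rightarrow> 'k) \<Rightarrow> bool" where
  "argmax_rule am \<longleftrightarrow> (\<forall>v. is_arg_max v (\<lambda>_. True) (am v))"

definition pred_class ::
  "(('k::finite \<Rightarrow> real) \<Rightarrow> 'k) \<Rightarrow> (real^'w::finite \<Rightarrow> real^'w^'k) \<Rightarrow> real^'w \<Rightarrow> 'w \<Rightarrow> 'k" where
  "pred_class am f x \<omega> = am (\<lambda>k. f x $ k $ \<omega>)"

text \<open>The scores are collected in a multiset, so that the two largest ones agree in case of a tie.
  \<open>top2\<close> is meaningful only if there are at least two classes.\<close>

definition scores :: "(real^'w::finite \<Rightarrow> real^'w^'k::finite) \<Rightarrow> real^'w \<Rightarrow> 'w \<Rightarrow> real multiset" where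
  "scores f x \<omega> = image_mset (\<lambda>k. f x $ k $ \<omega>) (mset_set UNIV)"

definition top1 :: "real multiset \<Rightarrow> real" where
  "top1 M = Max (set_mset M)"

definition top2 :: "real multiset \<Rightarrow> real" where
  "top2 M = top1 (M - {#top1 M#})"

definition margin :: "(real^'w::finite \<Rightarrow> real^'w^'k::finite) \<Rightarrow> real^'w \<Rightarrow> 'w \<Rightarrow> real" where
  "margin f x \<omega> = top1 (scores f x \<omega>) - top2 (scores f x \<omega>)"

definition pixel_robustness ::
  "real \<Rightarrow> real \<Rightarrow> (('k::finite \<Rightarrow> real) \<Rightarrow> 'k) \<Rightarrow> (real^'w::finite \<Rightarrow> real^'w^'k) \<Rightarrow>
   real^'w \<Rightarrow> ('w \<Rightarrow> 'k) \<Rightarrow> 'w \<Rightarrow> real" where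
  "pixel_robustness p L am f x y \<omega> =
     of_bool (pred_class am f x \<omega> = y \<omega>) * 2 powr ((1 - p) / p) * margin f x \<omega> / L"

text \<open>Valued in \<open>[0, \<infinity>]\<close>, where the infimum of the empty set is \<open>\<infinity>\<close>.\<close>

definition accuracy_robustness ::
  "real \<Rightarrow> (('k::finite \<Rightarrow> real) \<Rightarrow> 'k) \<Rightarrow> (real^'w::finite \<Rightarrow> real^'w^'k) \<Rightarrow>
   'w set \<Rightarrow> real \<Rightarrow> real^'w \<Rightarrow> ('w \<Rightarrow> 'k) \<Rightarrow> ennreal" where
  "accuracy_robustness p am f S \<gamma> x y =
     Inf (ennreal ` {\<epsilon>. 0 \<le> \<epsilon> \<and>
       (\<exists>x'\<in>lp_ball p \<epsilon> x.
          (1 / real (card S)) * (\<Sum>\<omega>\<in>S. of_bool (pred_class am f x' \<omega> = y \<omega>)) \<le> \<gamma>)})"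

text \<open>Real powers on \<open>[0, \<infinity>]\<close> for exponents \<open>p > 0\<close>.\<close>

definition ennreal_powr :: "ennreal \<Rightarrow> real \<Rightarrow> ennreal" where
  "ennreal_powr a p = (if a = top then top else ennreal (enn2real a powr p))"

end

theory Submission
  imports Defs
begin

text \<open>If \<open>x'\<close> is misclassified on \<open>T\<close>, then at each \<open>\<omega> \<in> T\<close> that \<open>x\<close> classifies correctly the scores
  of two classes move by a total of at least the margin; by the power mean inequality these two
  entries contribute at least \<open>2\<^bsup>1-p\<^esup>\<close> times the margin to the power \<open>p\<close> to the \<open>p\<close>-th power of
  the \<open>\<ell>\<^sub>p\<close> distance between the outputs. The entries belong to different pixels, so these
  contributions add up, and the Lipschitz bound gives \<open>(\<Sum>\<omega>\<in>T. R \<omega> powr p) \<le> \<epsilon> powr p\<close>. An accuracy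
  of at most \<open>\<gamma>\<close> forces \<open>T\<close> to have at least \<open>n\<close> elements, and the cheapest such set is a prefix of
  the sorted order.\<close>

section \<open>Power means and the \<open>p\<close>-norm\<close>

text \<open>Midpoint convexity of \<open>t powr p\<close>, scaled by \<open>2 powr p\<close>.
  Convexity is applied to positive arguments only; if one argument is zero, it is enough that
  \<open>2 powr (p - 1)\<close> is at least 1.\<close>

lemma powr_add_le:
  fixes a b p :: real
  assumes "1 \<le> p" and "0 \<le> a" and "0 \<le> b"
  shows "(a + b) powr p \<le> 2 powr (p - 1) * (a powr p + b powr p)"
proof (cases "a = 0 \<or> b = 0")
  case True
  have "1 \<le> 2 powr (p - 1)"
    using assms(1) by (simp add: ge_one_powr_ge_zero)
  then have "1 * (a powr p + b powr p) \<le> 2 powr (p - 1) * (a powr p + b powr p)"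
    by (intro mult_right_mono) simp_all
  then show ?thesis using True assms(1) by auto
next
  case False
  then have "((1 - 1/2) *\<^sub>R a + (1/2) *\<^sub>R b) powr p \<le> (1 - 1/2) * a powr p + 1/2 * b powr p"
    using convex_onD[OF powr_convex[OF assms(1)], of "1/2" a b] assms by simp
  then have "((a + b) / 2) powr p \<le> (a powr p + b powr p) / 2"
    by (simp add: field_simps)
  then show ?thesis
    using assms by (simp add: powr_divide powr_diff field_simps)
qed

lemma lp_norm_powr:
  assumes "0 < p"
  shows "lp_norm p v powr p = (\<Sum>i\<in>UNIV. \<bar>v i\<bar> powr p)"
  using assms by (simp add: lp_norm_def powr_powr sum_nonneg)

lemma lp_norm_nonneg: "0 \<le> lp_norm p v"
  by (simp add: lp_norm_def)

section \<open>Margins\<close>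

text \<open>For any maximising class \<open>j\<close>, deleting one copy of the top score from the
  multiset amounts to deleting class \<open>j\<close>, so \<open>top2\<close> is the maximum over
  the other classes, even at a tie.\<close>

lemma margin_eq:
  fixes f :: "real^'w::finite \<Rightarrow> real^'w^'k::finite"
  assumes "\<And>k. f x $ k $ \<omega> \<le> f x $ j $ \<omega>"
  shows "margin f x \<omega> = f x $ j $ \<omega> - Max ((\<lambda>k. f x $ k $ \<omega>) ` (UNIV - {j}))"
proof -
  have t1: "top1 (scores f x \<omega>) = f x $ j $ \<omega>"
    unfolding top1_def scores_def by (rule Max_eqI) (use assms in auto)
  have "mset_set (UNIV :: 'k set) = add_mset j (mset_set (UNIV - {j}))"
    by (simp add: mset_set.remove)
  then have "scores f x \<omega> - {#f x $ j $ \<omega>#} = image_mset (\<lambda>k. f x $ k $ \<omega>) (mset_set (UNIV - {j}))"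
    by (simp add: scores_def)
  then show ?thesis
    by (simp add: margin_def top2_def t1) (simp add: top1_def)
qed

lemma margin_le:
  assumes "\<And>k. f x $ k $ \<omega> \<le> f x $ j $ \<omega>" and "k \<noteq> j"
  shows "margin f x \<omega> \<le> f x $ j $ \<omega> - f x $ k $ \<omega>"
  unfolding margin_eq[of f x \<omega> j, OF assms(1)] using assms(2) by (auto intro!: Max_ge)

lemma margin_nonneg:
  fixes f :: "real^'w::finite \<Rightarrow> real^'w^'k::finite"
  assumes "CARD('k) \<ge> 2"
  shows "0 \<le> margin f x \<omega>"
proof -
  have "finite (range (\<lambda>k. f x $ k $ \<omega>))" by simp
  then have "Max (range (\<lambda>k. f x $ k $ \<omega>)) \<in> range (\<lambda>k. f x $ k $ \<omega>)"
    by (rule Max_in) simp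
  then obtain j where "Max (range (\<lambda>k. f x $ k $ \<omega>)) = f x $ j $ \<omega>" by blast
  then have j: "f x $ k $ \<omega> \<le> f x $ j $ \<omega>" for k
    by (metis Max_ge finite finite_imageI rangeI)
  \<comment> \<open>With two classes some class differs from \<open>j\<close>, so the maximum over
    the others is genuine.\<close>
  have "card (UNIV - {j}) \<noteq> 0"
    using assms by simp
  then have "UNIV - {j} \<noteq> {}" by force
  then show ?thesis
    unfolding margin_eq[of f x \<omega> j, OF j] using j by (auto intro!: Max.boundedI)
qed

section \<open>Per-pixel robustness and the Lipschitz bound\<close>

lemma pixel_robustness_nonneg:
  fixes f :: "real^'w::finite \<Rightarrow> real^'w^'k::finite"
  assumes "CARD('k) \<ge> 2" and "0 < L"
  shows "0 \<le> pixel_robustness p L am f x y \<omega>"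
  using assms margin_nonneg[OF assms(1)] by (auto simp: pixel_robustness_def intro!: divide_nonneg_pos mult_nonneg_nonneg)

lemma pixel_robustness_powr_le:
  fixes f :: "real^'w::finite \<Rightarrow> real^'w^'k::finite"
  assumes K: "CARD('k) \<ge> 2" and p: "1 \<le> p" and L: "0 < L" and am: "argmax_rule am"
    and mis: "pred_class am f x' \<omega> \<noteq> y \<omega>"
  shows "L powr p * pixel_robustness p L am f x y \<omega> powr p
           \<le> (\<Sum>k\<in>UNIV. \<bar>(f x' - f x) $ k $ \<omega>\<bar> powr p)"
proof (cases "pred_class am f x \<omega> = y \<omega>")
  \<comment> \<open>The indicator makes the robustness zero, so the left side vanishes.\<close>
  case False
  then show ?thesis
    using p by (simp add: pixel_robustness_def sum_nonneg)
next
  case True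
  define j k where "j = y \<omega>" and "k = pred_class am f x' \<omega>"
  define a b where "a = \<bar>(f x' - f x) $ j $ \<omega>\<bar>" and "b = \<bar>(f x' - f x) $ k $ \<omega>\<bar>"
  have jk: "k \<noteq> j" using mis by (simp add: j_def k_def)
  have top: "f z $ i $ \<omega> \<le> f z $ pred_class am f z \<omega> $ \<omega>" for z i
    using am[unfolded argmax_rule_def is_arg_max_linorder, rule_format, of "\<lambda>k. f z $ k $ \<omega>"]
    by (simp add: pred_class_def)
  have "margin f x \<omega> \<le> f x $ j $ \<omega> - f x $ k $ \<omega>"
    using top[of x] True jk by (intro margin_le) (simp_all add: j_def)
  \<comment> \<open>At \<open>x'\<close> class \<open>k\<close> scores at least as high as
    \<open>j\<close>, so the gap between them at \<open>x\<close> is closed by the moves of these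
    two entries alone.\<close>
  also have "\<dots> \<le> a + b"
    using top[of x' j] by (simp add: a_def b_def k_def)
  finally have "margin f x \<omega> powr p \<le> (a + b) powr p"
    using margin_nonneg[OF K] p by (intro powr_mono2) auto
  also have "\<dots> \<le> 2 powr (p - 1) * (a powr p + b powr p)"
    by (rule powr_add_le[OF p]) (simp_all add: a_def b_def)
  finally have *: "2 powr (1 - p) * margin f x \<omega> powr p \<le> a powr p + b powr p"
    by (simp add: powr_diff field_simps)
  \<comment> \<open>The \<open>p\<close>-th power of the factor \<open>2 powr ((1 - p) / p)\<close>
    in the robustness is the reciprocal of the constant in \<open>powr_add_le\<close>.\<close>
  have "L powr p * pixel_robustness p L am f x y \<omega> powr p = 2 powr (1 - p) * margin f x \<omega> powr p"
    using True L p margin_nonneg[OF K, of f x \<omega>]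
    by (simp add: pixel_robustness_def powr_divide powr_mult powr_powr)
  also note *
  also have "a powr p + b powr p = (\<Sum>i\<in>{j, k}. \<bar>(f x' - f x) $ i $ \<omega>\<bar> powr p)"
    using jk by (simp add: a_def b_def)
  also have "\<dots> \<le> (\<Sum>k\<in>UNIV. \<bar>(f x' - f x) $ k $ \<omega>\<bar> powr p)"
    by (rule sum_mono2) auto
  finally show ?thesis .
qed

lemma sum_pixel_robustness_powr_le:
  fixes f :: "real^'w::finite \<Rightarrow> real^'w^'k::finite"
  assumes K: "CARD('k) \<ge> 2" and p: "1 \<le> p" and L: "0 < L" and lip: "lp_lipschitz p L f"
    and am: "argmax_rule am" and x: "x \<in> unit_cube" and x': "x' \<in> lp_ball p \<epsilon> x"
    and mis: "\<And>\<omega>. \<omega> \<in> T \<Longrightarrow> pred_class am f x' \<omega> \<noteq> y \<omega>"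
  shows "(\<Sum>\<omega>\<in>T. pixel_robustness p L am f x y \<omega> powr p) \<le> \<epsilon> powr p"
proof -
  have "lp_norm_mat p (f x' - f x) \<le> L * lp_norm_vec p (x' - x)"
    using lip x x' by (auto simp: lp_lipschitz_def lp_ball_def)
  also have "\<dots> \<le> L * \<epsilon>"
    using L x' by (simp add: lp_ball_def)
  finally have "lp_norm_mat p (f x' - f x) powr p \<le> (L * \<epsilon>) powr p"
    using p lp_norm_nonneg by (intro powr_mono2) auto
  moreover have "L powr p * (\<Sum>\<omega>\<in>T. pixel_robustness p L am f x y \<omega> powr p)
      \<le> (\<Sum>\<omega>\<in>T. \<Sum>k\<in>UNIV. \<bar>(f x' - f x) $ k $ \<omega>\<bar> powr p)"
    unfolding sum_distrib_left
    by (intro sum_mono pixel_robustness_powr_le[OF K p L am] mis)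
  moreover have "\<dots> \<le> (\<Sum>\<omega>\<in>UNIV. \<Sum>k\<in>UNIV. \<bar>(f x' - f x) $ k $ \<omega>\<bar> powr p)"
    by (intro sum_mono2 sum_nonneg) auto
  \<comment> \<open>The norm sums over pairs with the class first, whereas the estimate groups
    entries by pixel; hence the exchange of sums.\<close>
  moreover have "\<dots> = lp_norm_mat p (f x' - f x) powr p"
  proof -
    have "lp_norm_mat p (f x' - f x) powr p
        = (\<Sum>(k, \<omega>)\<in>UNIV \<times> UNIV. \<bar>(f x' - f x) $ k $ \<omega>\<bar> powr p)"
      using p by (simp add: lp_norm_powr case_prod_unfold)
    also have "\<dots> = (\<Sum>k\<in>UNIV. \<Sum>\<omega>\<in>UNIV. \<bar>(f x' - f x) $ k $ \<omega>\<bar> powr p)"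
      by (rule sum.cartesian_product[symmetric])
    also have "\<dots> = (\<Sum>\<omega>\<in>UNIV. \<Sum>k\<in>UNIV. \<bar>(f x' - f x) $ k $ \<omega>\<bar> powr p)"
      by (rule sum.swap)
    finally show ?thesis ..
  qed
  moreover have "(L * \<epsilon>) powr p = L powr p * \<epsilon> powr p"
  proof -
    \<comment> \<open>The radius is nonnegative because the ball contains \<open>x'\<close>.\<close>
    have "0 \<le> \<epsilon>"
      using x' order_trans[OF lp_norm_nonneg] by (auto simp: lp_ball_def simp del: vector_minus_component)
    then show ?thesis using L by (simp add: powr_mult)
  qed
  ultimately have "L powr p * (\<Sum>\<omega>\<in>T. pixel_robustness p L am f x y \<omega> powr p) \<le> L powr p * \<epsilon> powr p"
    by linarith
  then show ?thesis
    using L by simp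
qed

section \<open>Counting and minimal subset sums\<close>

text \<open>At most \<open>\<gamma> * card S\<close> pixels are correct, so at least
  \<open>(1 - \<gamma>) * card S\<close> are wrong; a cardinality is an integer, which allows
  rounding up.\<close>

lemma card_misclassified_ge:
  assumes "finite S" and "S \<noteq> {}"
    and "(1 / real (card S)) * (\<Sum>\<omega>\<in>S. of_bool (P \<omega>)) \<le> \<gamma>"
  shows "nat \<lceil>(1 - \<gamma>) * real (card S)\<rceil> \<le> card {\<omega> \<in> S. \<not> P \<omega>}"
proof -
  have "S = {\<omega> \<in> S. P \<omega>} \<union> {\<omega> \<in> S. \<not> P \<omega>}" by blast
  then have "card S = card {\<omega> \<in> S. P \<omega>} + card {\<omega> \<in> S. \<not> P \<omega>}"
    using assms(1) by (metis (no_types, lifting) card_Un_disjoint disjoint_iff finite_Un mem_Collect_eq)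
  moreover have "real (card {\<omega> \<in> S. P \<omega>}) \<le> \<gamma> * real (card S)"
    using assms by (simp add: of_bool_def sum.If_cases Int_def field_simps card_gt_0_iff)
  ultimately have "(1 - \<gamma>) * real (card S) \<le> real (card {\<omega> \<in> S. \<not> P \<omega>})"
    by (simp add: algebra_simps)
  then show ?thesis
    by (simp add: ceiling_le_iff nat_le_iff)
qed

text \<open>An exchange argument with threshold \<open>a n\<close>: outside the common part, prefix
  terms are at most \<open>a n\<close>, terms of \<open>T\<close> are at least \<open>a n\<close>,
  and \<open>T\<close> has no fewer of them. Nonnegativity of \<open>a n\<close> handles the
  surplus.\<close>

lemma sum_prefix_le:
  fixes a :: "nat \<Rightarrow> real"
  assumes mono: "mono_on {1..N} a" and nonneg: "\<And>i. i \<in> {1..N} \<Longrightarrow> 0 \<le> a i"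
    and T: "T \<subseteq> {1..N}" and n: "n \<le> card T"
  shows "sum a {1..n} \<le> sum a T"
proof (cases "n = 0")
  \<comment> \<open>Kept apart because the threshold \<open>a 0\<close> lies outside the range of
    the hypotheses.\<close>
  case True
  then show ?thesis using nonneg T by (auto intro!: sum_nonneg)
next
  case False
  have fin: "finite T" using T finite_subset by blast
  have "n \<le> N"
    using n card_mono[OF _ T] by simp
  then have nN: "n \<in> {1..N}" using False by simp
  have "card ({1..n} - T) \<le> card (T - {1..n})"
    using n fin by (simp add: card_Diff_subset_Int Int_commute)
  then have c: "real (card ({1..n} - T)) * a n \<le> real (card (T - {1..n})) * a n"
    using nonneg[OF nN] by (intro mult_right_mono) auto
  have "sum a ({1..n} - T) \<le> real (card ({1..n} - T)) * a n"
    using mono \<open>n \<le> N\<close> by (intro sum_bounded_above) (auto simp: mono_on_def)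
  also note c
  also have "real (card (T - {1..n})) * a n \<le> sum a (T - {1..n})"
    using mono nN T by (intro sum_bounded_below) (auto simp: mono_on_def subset_iff)
  finally show ?thesis
    using fin sum.Int_Diff[of "{1..n}" a T] sum.Int_Diff[of T a "{1..n}"]
    by (simp add: Int_commute)
qed

text \<open>On \<open>S\<close> a 0/1 weighting is the indicator of the set where it equals 1. This
  turns the minimum over weightings into one over a finite family of subsets.\<close>

lemma weighted_sums_eq_subset_sums:
  fixes c :: "'w::finite \<Rightarrow> real"
  shows "{(\<Sum>\<omega>\<in>S. c \<omega> * q \<omega>) | q :: 'w \<Rightarrow> real.
            (\<forall>\<omega>\<in>S. q \<omega> \<in> {0, 1}) \<and> (\<Sum>\<omega>\<in>S. q \<omega>) \<ge> real n}
         = sum c ` {T. T \<subseteq> S \<and> n \<le> card T}" (is "?A = ?B")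
proof
  show "?A \<subseteq> ?B"
  proof clarify
    fix q :: "'w \<Rightarrow> real"
    assume q: "\<forall>\<omega>\<in>S. q \<omega> \<in> {0, 1}" "real n \<le> sum q S"
    let ?T = "{\<omega> \<in> S. q \<omega> = 1}"
    have "sum q S = (\<Sum>\<omega>\<in>S. if q \<omega> = 1 then 1 else 0)"
      using q(1) by (intro sum.cong) auto
    then have "n \<le> card ?T"
      using q(2) by (simp add: sum.If_cases Int_def)
    moreover have "(\<Sum>\<omega>\<in>S. c \<omega> * q \<omega>) = (\<Sum>\<omega>\<in>S. if q \<omega> = 1 then c \<omega> else 0)"
      using q(1) by (intro sum.cong) auto
    ultimately show "(\<Sum>\<omega>\<in>S. c \<omega> * q \<omega>) \<in> ?B"
      by (intro image_eqI[of _ _ ?T]) (simp_all add: sum.If_cases Int_def)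
  qed
next
  show "?B \<subseteq> ?A"
  proof clarify
    fix T
    assume T: "T \<subseteq> S" "n \<le> card T"
    have "(\<Sum>\<omega>\<in>S. c \<omega> * of_bool (\<omega> \<in> T)) = sum c T" "(\<Sum>\<omega>\<in>S. of_bool (\<omega> \<in> T)) = real (card T)"
      using T(1) by (simp_all add: of_bool_def if_distrib sum.If_cases Int_absorb1 cong: if_cong)
    then show "\<exists>q. sum c T = (\<Sum>\<omega>\<in>S. c \<omega> * q \<omega>) \<and> (\<forall>\<omega>\<in>S. q \<omega> \<in> {0, 1}) \<and> real n \<le> sum q S"
      using T(2) by (intro exI[of _ "\<lambda>\<omega>. of_bool (\<omega> \<in> T)"]) auto
  qed
qed

lemma Min_subset_sums_eq_prefix_sum:
  fixes c :: "'w::finite \<Rightarrow> real"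
  assumes bij: "bij_betw \<pi> {1..card S} S" and mono: "mono_on {1..card S} (\<lambda>i. c (\<pi> i))"
    and nonneg: "\<And>\<omega>. 0 \<le> c \<omega>" and n: "n \<le> card S"
  shows "Min (sum c ` {T. T \<subseteq> S \<and> n \<le> card T}) = (\<Sum>k=1..n. c (\<pi> k))"
proof (rule Min_eqI)
  have sub: "{1..n} \<subseteq> {1..card S}" using n by auto
  then have inj: "inj_on \<pi> {1..n}"
    using bij bij_betw_imp_inj_on inj_on_subset by blast
  have "\<pi> ` {1..n} \<subseteq> S"
    using bij sub bij_betw_imp_surj_on by blast
  then show "(\<Sum>k=1..n. c (\<pi> k)) \<in> sum c ` {T. T \<subseteq> S \<and> n \<le> card T}"
    using inj by (intro image_eqI[of _ _ "\<pi> ` {1..n}"]) (auto simp: sum.reindex card_image)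
next
  fix s
  assume "s \<in> sum c ` {T. T \<subseteq> S \<and> n \<le> card T}"
  then obtain T where T: "T \<subseteq> S" "n \<le> card T" and s: "s = sum c T" by blast
  \<comment> \<open>Pulling \<open>T\<close> back along the bijection reduces the comparison to sets
    of indices.\<close>
  then obtain U where U: "U \<subseteq> {1..card S}" "T = \<pi> ` U"
    using bij by (metis bij_betw_imp_surj_on subset_image_iff)
  have inj: "inj_on \<pi> U"
    using bij U bij_betw_imp_inj_on inj_on_subset by blast
  have "(\<Sum>k=1..n. c (\<pi> k)) \<le> (\<Sum>i\<in>U. c (\<pi> i))"
    using mono nonneg U T(2) inj by (intro sum_prefix_le[of "card S"]) (auto simp: card_image)
  then show "(\<Sum>k=1..n. c (\<pi> k)) \<le> s"
    using inj by (simp add: s U sum.reindex)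
qed simp

text \<open>Each element of \<open>E\<close> is at least the \<open>p\<close>-th root of
  \<open>m\<close>, hence so is the infimum, and raising to the power \<open>p\<close> recovers
  \<open>m\<close>. An infinite infimum, as for empty \<open>E\<close>, has infinite power.\<close>

lemma ennreal_le_ennreal_powr_Inf:
  assumes p: "0 < p" and m: "0 \<le> m"
    and le: "\<And>\<epsilon>. \<epsilon> \<in> E \<Longrightarrow> 0 \<le> \<epsilon> \<and> m \<le> \<epsilon> powr p"
  shows "ennreal m \<le> ennreal_powr (Inf (ennreal ` E)) p"
proof -
  have "ennreal (m powr (1 / p)) \<le> Inf (ennreal ` E)"
  proof (rule Inf_greatest, clarify)
    fix \<epsilon>
    assume "\<epsilon> \<in> E"
    then have "m powr (1 / p) \<le> (\<epsilon> powr p) powr (1 / p)" and "0 \<le> \<epsilon>"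
      using le[of \<epsilon>] p m by (auto intro!: powr_mono2)
    then show "ennreal (m powr (1 / p)) \<le> ennreal \<epsilon>"
      using p by (simp add: powr_powr ennreal_leI)
  qed
  then show ?thesis
  proof (cases "Inf (ennreal ` E)")
    case (real r)
    with \<open>ennreal (m powr (1 / p)) \<le> _\<close> have "m powr (1 / p) \<le> r"
      by simp
    then have "(m powr (1 / p)) powr p \<le> r powr p"
      using p by (intro powr_mono2) auto
    then show ?thesis
      using real p m by (simp add: ennreal_powr_def powr_powr ennreal_leI)
  qed (simp add: ennreal_powr_def)
qed

theorem mainTheorem3:
  fixes p L \<gamma> :: real
    and f :: "real^'w::finite \<Rightarrow> real^'w^'k::finite"
    and am :: "('k \<Rightarrow> real) \<Rightarrow> 'k"
    and S :: "'w set"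
    and x :: "real^'w"
    and y :: "'w \<Rightarrow> 'k"
  assumes "CARD('k) \<ge> 2"
    and "1 \<le> p" and "0 < L"
    and "lp_lipschitz p L f"
    and "argmax_rule am"
    and "S \<noteq> {}"
    and "0 \<le> \<gamma>" and "\<gamma> \<le> 1"
    and "x \<in> unit_cube"
  shows
    "let R = pixel_robustness p L am f x y;
         c = (\<lambda>\<omega>. R \<omega> powr p);
         n = nat \<lceil>(1 - \<gamma>) * real (card S)\<rceil>;
         m = Min {(\<Sum>\<omega>\<in>S. c \<omega> * q \<omega>) | q :: 'w \<Rightarrow> real.
                    (\<forall>\<omega>\<in>S. q \<omega> \<in> {0, 1}) \<and> (\<Sum>\<omega>\<in>S. q \<omega>) \<ge> real n}
     in ennreal_powr (accuracy_robustness p am f S \<gamma> x y) p \<ge> ennreal m \<and>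
        (\<forall>\<pi> :: nat \<Rightarrow> 'w.
           bij_betw \<pi> {1..card S} S \<and> mono_on {1..card S} (\<lambda>i. R (\<pi> i)) \<longrightarrow>
           m = (\<Sum>k=1..n. R (\<pi> k) powr p))"
proof -
  define R where "R = pixel_robustness p L am f x y"
  define c where "c = (\<lambda>\<omega>. R \<omega> powr p)"
  define n where "n = nat \<lceil>(1 - \<gamma>) * real (card S)\<rceil>"
  define m where "m = Min (sum c ` {T. T \<subseteq> S \<and> n \<le> card T})"
  have R0: "0 \<le> R \<omega>" for \<omega>
    unfolding R_def by (rule pixel_robustness_nonneg[OF assms(1,3)])
  have "(1 - \<gamma>) * real (card S) \<le> real (card S)"
    using \<open>0 \<le> \<gamma>\<close> by (simp add: algebra_simps)
  then have nS: "n \<le> card S"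
    by (simp add: n_def ceiling_le_iff nat_le_iff)
  \<comment> \<open>The family under the minimum is nonempty: \<open>S\<close> itself belongs to it,
    by \<open>nS\<close>.\<close>
  have m0: "0 \<le> m"
    unfolding m_def using nS by (intro Min.boundedI) (auto simp: c_def intro!: sum_nonneg)
  have "ennreal m \<le> ennreal_powr (accuracy_robustness p am f S \<gamma> x y) p"
    unfolding accuracy_robustness_def
  proof (rule ennreal_le_ennreal_powr_Inf)
    fix \<epsilon>
    assume "\<epsilon> \<in> {\<epsilon>. 0 \<le> \<epsilon> \<and> (\<exists>x'\<in>lp_ball p \<epsilon> x.
      (1 / real (card S)) * (\<Sum>\<omega>\<in>S. of_bool (pred_class am f x' \<omega> = y \<omega>)) \<le> \<gamma>)}"
    then obtain x' where "0 \<le> \<epsilon>" and x': "x' \<in> lp_ball p \<epsilon> x"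
      and acc: "(1 / real (card S)) * (\<Sum>\<omega>\<in>S. of_bool (pred_class am f x' \<omega> = y \<omega>)) \<le> \<gamma>"
      by blast
    let ?T = "{\<omega> \<in> S. pred_class am f x' \<omega> \<noteq> y \<omega>}"
    have "n \<le> card ?T"
      unfolding n_def using card_misclassified_ge[OF _ \<open>S \<noteq> {}\<close> acc] by simp
    then have "m \<le> sum c ?T"
      unfolding m_def by (intro Min_le) auto
    also have "\<dots> \<le> \<epsilon> powr p"
      unfolding c_def R_def
      by (rule sum_pixel_robustness_powr_le[OF assms(1-5,9) x']) simp
    finally show "0 \<le> \<epsilon> \<and> m \<le> \<epsilon> powr p"
      using \<open>0 \<le> \<epsilon>\<close> by simp
  qed (use \<open>1 \<le> p\<close> m0 in auto)
  moreover have "m = (\<Sum>k=1..n. R (\<pi> k) powr p)"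
    if "bij_betw \<pi> {1..card S} S" and "mono_on {1..card S} (\<lambda>i. R (\<pi> i))" for \<pi>
  proof -
    \<comment> \<open>Sorting by \<open>R\<close> also sorts by \<open>c\<close>, since the
      \<open>p\<close>-th power is increasing on nonnegative reals.\<close>
    have "mono_on {1..card S} (\<lambda>i. c (\<pi> i))"
      using that(2) R0 \<open>1 \<le> p\<close> by (auto simp: mono_on_def c_def intro!: powr_mono2)
    then show ?thesis
      unfolding m_def
      by (subst Min_subset_sums_eq_prefix_sum[OF that(1) _ _ nS]) (simp_all add: c_def)
  qed
  ultimately show ?thesis
    unfolding Let_def weighted_sums_eq_subset_sums
    by (simp add: m_def c_def n_def R_def)
qed

end
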